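(* Let $q$ be a prime power with characteristic $p$, $r\geqslant1$, and let $f(X)=u(X)/v(X)$ where $u(X),v(X)\in\mathbb{F}_{q^r}[X]$ are nonzero polynomials with $\gcd(u(X),v(X))=1$, $$\deg u\leqslant \deg v+1\qquad\text{and}\qquad \gcd(\deg v,p)=1.$$ Assume that for every $\omega\in\mathbb{F}_{q^r}^*$ the polynomial $v(X)v(X+\omega)$ is not divisible by the $p$-th power of a nonconstant polynomial. Then $f(X)\in\mathcal{F}_d(q)$, where $d$ is the degree of $f$.
   Context: $\mathcal{F}_d(q)$ is the set of rational functions $f(X)\in\mathbb{F}_{q^r}(X)$ of degree $d$ such that for every $\omega\in\mathbb{F}_{q^r}^*$ the function $f(X+\omega)-f(X)$ is not of the form $\alpha(g(X)^p-g(X))+\beta X$ for any rational function $g(X)\in\overline{\mathbb{F}_q}(X)$ and any $\alpha,\beta\in\mathbb{F}_{q^r}$; here $\overline{\mathbb{F}_q}$ is the algebraic closure of $\mathbb{F}_q$. *)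

theory Defs
  imports
    "HOL-Computational_Algebra.Computational_Algebra"
    "HOL-Algebra.Algebraic_Closure_Type"
begin

text \<open>
  Throughout, the type \<open>'a :: finite_field\<close> plays the role of $\mathbb{F}_{q^r}$, so that
  \<open>'a poly fract\<close> is the field $\mathbb{F}_{q^r}(X)$. An algebraic closure of
  $\mathbb{F}_{q^r}$ is one of $\mathbb{F}_q$ as well, so $\overline{\mathbb{F}_q}(X)$ is
  \<open>'a alg_closure poly fract\<close>.
\<close>

definition ratfun_degree :: "'a::field poly fract \<Rightarrow> nat" where
  "ratfun_degree f =
     (THE d. \<exists>u v. v \<noteq> 0 \<and> coprime u v \<and> f = Fract u v \<and> d = max (degree u) (degree v))"

lemma poly_bezout:
  fixes u v :: "'a::field poly"
  assumes "coprime u v"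
  shows "\<exists>a b. a * u + b * v = 1"
  using assms
proof (induction "euclidean_size v" arbitrary: u v rule: less_induct)
  case less
  show ?case
  proof (cases "v = 0")
    case True
    then have "u dvd 1" using less.prems by simp
    then obtain a where "1 = u * a" by (rule dvdE)
    then have "a * u + 0 * v = 1" by (simp add: mult.commute)
    then show ?thesis by blast
  next
    case False
    have "coprime v (u mod v)"
    proof (rule coprimeI)
      fix c assume "c dvd v" "c dvd u mod v"
      then have "c dvd u" by (simp add: dvd_mod_iff)
      then show "is_unit c" using \<open>c dvd v\<close> less.prems coprime_common_divisor by blast
    qed
    then obtain a b where ab: "a * v + b * (u mod v) = 1"
      using less.hyps[of "u mod v" v] mod_size_less[OF False] by blast
    have "b * u + (a - b * (u div v)) * v = a * v + b * (u - u div v * v)"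
      by (simp add: algebra_simps)
    also have "\<dots> = 1"
      using ab by (simp only: minus_div_mult_eq_mod)
    finally have "b * u + (a - b * (u div v)) * v = 1" .
    then show ?thesis by blast
  qed
qed

lemma poly_coprime_dvd_multD:
  fixes u v w :: "'a::field poly"
  assumes "coprime u v" "u dvd v * w"
  shows "u dvd w"
proof -
  obtain a b where "a * u + b * v = 1" using poly_bezout[OF assms(1)] by blast
  then have "w = (a * u + b * v) * w" by simp
  also have "\<dots> = u * (a * w) + b * (v * w)" by (simp add: algebra_simps)
  finally show ?thesis
    using assms(2) by (metis dvd_add dvd_mult dvd_triv_left)
qed

lemma ratfun_degree_Fract:
  fixes u v :: "'a::field poly"
  assumes "v \<noteq> 0" "coprime u v"
  shows "ratfun_degree (Fract u v) = max (degree u) (degree v)"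
  unfolding ratfun_degree_def
proof (rule the_equality)
  show "\<exists>a b. b \<noteq> 0 \<and> coprime a b \<and> Fract u v = Fract a b \<and>
          max (degree u) (degree v) = max (degree a) (degree b)"
    using assms by blast
next
  fix d
  assume "\<exists>a b. b \<noteq> 0 \<and> coprime a b \<and> Fract u v = Fract a b \<and>
            d = max (degree a) (degree b)"
  then obtain a b where ab: "b \<noteq> 0" "coprime a b" "Fract u v = Fract a b"
    and d: "d = max (degree a) (degree b)"
    by blast
  have eq: "u * b = a * v"
    using ab(1,3) assms(1) by (simp add: eq_fract)
  have co: "coprime v u" "coprime b a"
    using assms(2) ab(2) by (simp_all add: coprime_commute)
  have "v dvd u * b" "b dvd a * v" "u dvd v * a" "a dvd b * u"
    using eq by (metis dvd_triv_left dvd_triv_right mult.commute)+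
  then have dvds: "v dvd b" "b dvd v" "u dvd a" "a dvd u"
    using poly_coprime_dvd_multD co assms(2) ab(2) by blast+
  have "degree v = degree b"
    using dvds(1,2) ab(1) assms(1) by (simp add: dvd_imp_degree_le order_antisym)
  moreover have "degree u = degree a"
    using dvds(3,4) by (cases "u = 0") (auto simp: dvd_imp_degree_le order_antisym)
  ultimately show "d = max (degree u) (degree v)"
    using d by simp
qed

text \<open>
  The extension of an injective homomorphism \<open>h\<close> of integral domains to the fraction fields; the
  next lemma shows that the description is independent of the chosen representative.
\<close>

definition fract_map :: "('a::idom \<Rightarrow> 'b::idom) \<Rightarrow> 'a fract \<Rightarrow> 'b fract" where
  "fract_map h f = (THE y. \<exists>a b. b \<noteq> 0 \<and> f = Fract a b \<and> y = Fract (h a) (h b))"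

lemma fract_map_Fract:
  assumes mult: "\<And>x y. h (x * y) = h x * h y"
    and nonzero: "\<And>x. x \<noteq> 0 \<Longrightarrow> h x \<noteq> 0"
    and "b \<noteq> 0"
  shows "fract_map h (Fract a b) = Fract (h a) (h b)"
  unfolding fract_map_def
proof (rule the_equality)
  show "\<exists>c d. d \<noteq> 0 \<and> Fract a b = Fract c d \<and> Fract (h a) (h b) = Fract (h c) (h d)"
    using \<open>b \<noteq> 0\<close> by blast
next
  fix y
  assume "\<exists>c d. d \<noteq> 0 \<and> Fract a b = Fract c d \<and> y = Fract (h c) (h d)"
  then obtain c d where cd: "d \<noteq> 0" "Fract a b = Fract c d" "y = Fract (h c) (h d)"
    by blast
  have "a * d = c * b"
    using cd(1,2) \<open>b \<noteq> 0\<close> by (simp add: eq_fract)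
  then have "h a * h d = h c * h b"
    by (metis mult)
  then show "y = Fract (h a) (h b)"
    using cd(1,3) \<open>b \<noteq> 0\<close> nonzero by (simp add: eq_fract)
qed

text \<open>The substitution $f(X) \mapsto f(X + \omega)$.\<close>

definition ratfun_shift :: "'a::field \<Rightarrow> 'a poly fract \<Rightarrow> 'a poly fract" where
  "ratfun_shift \<omega> = fract_map (\<lambda>u. pcompose u [:\<omega>, 1:])"

lemma ratfun_shift_Fract:
  "v \<noteq> 0 \<Longrightarrow>
     ratfun_shift \<omega> (Fract u v) = Fract (pcompose u [:\<omega>, 1:]) (pcompose v [:\<omega>, 1:])"
  unfolding ratfun_shift_def
  by (rule fract_map_Fract) (auto simp: pcompose_mult pcompose_eq_0_iff)

lemma map_poly_to_ac_mult: "map_poly to_ac (u * v) = map_poly to_ac u * map_poly to_ac v"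
  by (intro poly_eqI) (simp add: coeff_map_poly coeff_mult to_ac_sum)

text \<open>The inclusion $\mathbb{F}_{q^r}(X) \subseteq \overline{\mathbb{F}_q}(X)$.\<close>

definition ratfun_to_ac :: "'a::field poly fract \<Rightarrow> 'a alg_closure poly fract" where
  "ratfun_to_ac = fract_map (map_poly to_ac)"

lemma ratfun_to_ac_Fract:
  "v \<noteq> 0 \<Longrightarrow> ratfun_to_ac (Fract u v) = Fract (map_poly to_ac u) (map_poly to_ac v)"
  unfolding ratfun_to_ac_def
  by (rule fract_map_Fract) (auto simp: map_poly_to_ac_mult map_poly_eq_0_iff)

text \<open>
  The set $\mathcal{F}_d(q)$. The ambient field $\mathbb{F}_{q^r}$ is given by the type, the
  characteristic $p$ is \<open>CHAR('a)\<close>, and \<open>Fract [:c:] 1\<close> is the constant function $c$.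
\<close>

definition ratfun_class :: "nat \<Rightarrow> 'a::finite_field poly fract set" where
  "ratfun_class d =
     {f. ratfun_degree f = d \<and>
         (\<forall>\<omega>::'a. \<omega> \<noteq> 0 \<longrightarrow>
            \<not> (\<exists>(g :: 'a alg_closure poly fract) (\<alpha>::'a) (\<beta>::'a).
                 ratfun_to_ac (ratfun_shift \<omega> f - f) =
                   Fract [:to_ac \<alpha>:] 1 * (g ^ CHAR('a) - g) +
                   Fract [:to_ac \<beta>:] 1 * Fract [:0, 1:] 1))}"

end

theory Submission
  imports Defs "HOL-Number_Theory.Residues"
begin

text \<open>
  Suppose \<open>f(X + \<omega>) - f(X) = \<alpha> (g\<^sup>p - g) + \<beta> X\<close>. The left-hand side has denominator
  \<open>w = v(X) v(X + \<omega>)\<close>. If \<open>\<alpha> \<noteq> 0\<close>, then every pole \<open>c\<close> of \<open>g\<close> makes \<open>(X - c)\<^sup>p\<close> divide \<open>w\<close>;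
  as finite fields are perfect, the \<open>p\<close>-th power of the minimal polynomial of \<open>c\<close> then divides \<open>w\<close>,
  which is excluded. Hence the left-hand side is a polynomial, so \<open>v(X)\<close> divides
  \<open>u(X) v(X + \<omega>)\<close> and therefore \<open>v(X + \<omega>) = v(X)\<close>. Comparing the coefficients below the leading
  ones gives \<open>p dvd deg v\<close>, a contradiction.
\<close>

section \<open>Extending coefficients to the algebraic closure\<close>

lemma map_poly_to_ac_add: "map_poly to_ac (p + q) = map_poly to_ac p + map_poly to_ac q"
  by (intro poly_eqI) (simp add: coeff_map_poly)

lemma map_poly_to_ac_diff: "map_poly to_ac (p - q) = map_poly to_ac p - map_poly to_ac q"
  by (intro poly_eqI) (simp add: coeff_map_poly)

lemma map_poly_to_ac_1: "map_poly to_ac 1 = 1"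
  by (intro poly_eqI) (simp add: coeff_map_poly)

lemma map_poly_to_ac_power: "map_poly to_ac (p ^ n) = map_poly to_ac p ^ n"
  by (induction n) (simp_all add: map_poly_to_ac_mult map_poly_to_ac_1)

lemma degree_map_poly_to_ac: "degree (map_poly to_ac p) = degree p"
  by (rule degree_map_poly) simp

lemma map_poly_to_ac_eq_0_iff: "map_poly to_ac p = 0 \<longleftrightarrow> p = 0"
  by (rule map_poly_eq_0_iff) auto

lemma map_poly_to_ac_eq_iff: "map_poly to_ac p = map_poly to_ac q \<longleftrightarrow> p = q"
  by (auto simp: poly_eq_iff coeff_map_poly)

lemma pderiv_map_poly_to_ac: "pderiv (map_poly to_ac p) = map_poly to_ac (pderiv p)"
  by (intro poly_eqI) (simp add: coeff_pderiv coeff_map_poly del: of_nat_Suc)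

section \<open>Divisibility and translates of polynomials\<close>

lemma poly_dvd_same_lead_imp_eq:
  fixes p q :: "'a::field poly"
  assumes "p dvd q" "p \<noteq> 0" "degree p = degree q" "lead_coeff p = lead_coeff q"
  shows "p = q"
proof -
  obtain c where c: "q = p * c" using assms(1) by (rule dvdE)
  have "q \<noteq> 0" using assms(2,4) by auto
  then have "c \<noteq> 0" using c by auto
  then have "degree c = 0" using assms(2,3) by (simp add: c degree_mult_eq)
  then obtain k where k: "c = [:k:]" by (rule degree_eq_zeroE)
  have "k = 1"
    using assms(2,4) unfolding c lead_coeff_mult k by simp
  then show ?thesis using c k by (simp add: one_pCons)
qed

text \<open>These are the two top terms of the binomial expansion of
  \<open>(X + \<omega>) ^ Suc m\<close>. The induction follows Horner's scheme,
  \<open>pcompose (pCons a p) r = [:a:] + r * pcompose p r\<close>.\<close>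

lemma coeff_pcompose_translate:
  fixes p :: "'a::comm_ring_1 poly"
  assumes "degree p \<le> Suc m"
  shows "coeff (pcompose p [:\<omega>, 1:]) (Suc m) = coeff p (Suc m) \<and>
         coeff (pcompose p [:\<omega>, 1:]) m = coeff p m + of_nat (Suc m) * \<omega> * coeff p (Suc m)"
  using assms
proof (induction p arbitrary: m)
  case 0
  then show ?case by simp
next
  case (pCons a p)
  show ?case
  proof (cases m)
    case 0
    have "degree p = 0"
      using pCons.prems 0 by (cases "p = 0") auto
    then obtain c where "p = [:c:]" by (rule degree_eq_zeroE)
    then show ?thesis using 0 by (simp add: pcompose_pCons)
  next
    case (Suc n)
    have deg: "degree p \<le> Suc n"
      using pCons.prems Suc by (cases "p = 0") auto
    \<comment> \<open>This kills the contribution of the constant term of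
      \<open>[:\<omega>, 1:]\<close> to the coefficient at \<open>Suc m\<close>.\<close>
    have "coeff (pcompose p [:\<omega>, 1:]) (Suc (Suc n)) = 0"
      using deg degree_pcompose_le[of p "[:\<omega>, 1:]"]
      by (intro coeff_eq_0) auto
    then show ?thesis
      using Suc pCons.IH[OF deg] by (simp add: pcompose_pCons algebra_simps)
  qed
qed

text \<open>Translation changes the coefficient just below the top by
  \<open>degree p * \<omega> * lead_coeff p\<close>, so invariance makes the degree vanish as an
  element of the ring.\<close>

lemma CHAR_dvd_degree_if_translation_invariant:
  fixes p :: "'a::idom poly"
  assumes "pcompose p [:\<omega>, 1:] = p" "\<omega> \<noteq> 0"
  shows "CHAR('a) dvd degree p"
proof (cases "degree p")
  case (Suc m)
  then have "coeff p m = coeff p m + of_nat (Suc m) * \<omega> * coeff p (Suc m)"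
    using coeff_pcompose_translate[of p m \<omega>] assms(1) by simp
  moreover have "coeff p (Suc m) \<noteq> 0"
    using Suc by (metis degree_0 leading_coeff_0_iff nat.simps(3))
  ultimately have "of_nat (Suc m) = (0::'a)"
    using assms(2) by simp
  then show ?thesis
    using Suc by (simp only: of_nat_eq_0_iff_char_dvd)
qed simp

section \<open>Perfectness of finite fields and separability\<close>

text \<open>Every element satisfies \<open>a ^ card UNIV = a\<close>, and the characteristic divides
  this exponent.\<close>

lemma finite_field_CHAR_root_exists:
  fixes a :: "'a::finite_field"
  obtains b where "b ^ CHAR('a) = a"
proof -
  obtain m where m: "card (UNIV :: 'a set) = CHAR('a) * m"
    using CHAR_dvd_CARD by (rule dvdE)
  have "(a ^ m) ^ CHAR('a) = a"
    using finite_field_power_card_eq_same[of a] by (simp add: m mult.commute flip: power_mult)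
  then show ?thesis by (rule that)
qed

text \<open>Only exponents divisible by the characteristic survive; take roots of the coefficients
  and use that Frobenius is additive.\<close>

lemma pderiv_eq_0_imp_CHAR_power:
  fixes p :: "'a::finite_field poly"
  assumes "pderiv p = 0"
  obtains s where "p = s ^ CHAR('a)"
proof -
  let ?c = "CHAR('a)"
  have c: "?c > 0" by simp
  have zero: "coeff p n = 0" if "\<not> ?c dvd n" for n
  proof (cases n)
    case 0
    then show ?thesis using that by simp
  next
    case (Suc k)
    have "of_nat (Suc k) * coeff p (Suc k) = 0"
      using assms by (metis coeff_pderiv coeff_0)
    then show ?thesis
      using that Suc of_nat_eq_0_iff_char_dvd[of "Suc k", where ?'a = 'a] by simp
  qed
  obtain b where b: "\<And>a::'a. b a ^ ?c = a"
    using finite_field_CHAR_root_exists by metis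
  \<comment> \<open>The range of \<open>i\<close> is generous: terms with
    \<open>?c * i > degree p\<close> vanish, since \<open>b 0 = 0\<close>.\<close>
  define s where "s = (\<Sum>i\<le>degree p. monom (b (coeff p (?c * i))) i)"
  have "s ^ ?c = (\<Sum>i\<le>degree p. monom (b (coeff p (?c * i))) i ^ ?c)"
    unfolding s_def by (rule freshmans_dream_sum) simp_all
  also have "\<dots> = (\<Sum>i\<le>degree p. monom (coeff p (?c * i)) (?c * i))"
    by (simp add: monom_power b mult.commute)
  also have "\<dots> = p"
  proof (rule poly_eqI)
    fix n
    show "coeff (\<Sum>i\<le>degree p. monom (coeff p (?c * i)) (?c * i)) n = coeff p n"
    proof (cases "?c dvd n")
      case True
      then obtain k where k: "n = ?c * k" by (rule dvdE)
      have "coeff p n = 0" if "k > degree p"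
      proof (rule coeff_eq_0)
        have "k \<le> ?c * k" using c by (cases ?c) simp_all
        then show "degree p < n" using that unfolding k by linarith
      qed
      then show ?thesis
        using k c by (auto simp: coeff_sum sum.delta not_le)
    next
      case False
      then show ?thesis
        using zero by (auto simp: coeff_sum intro!: sum.neutral)
    qed
  qed
  finally show ?thesis using that by metis
qed

text \<open>The polynomial \<open>h\<close> is the minimal polynomial of \<open>c\<close>, up to a scalar.\<close>

lemma alg_closure_separable_minimal_poly:
  fixes c :: "'a::finite_field alg_closure" and w :: "'a poly"
  assumes "w \<noteq> 0" "poly (map_poly to_ac w) c = 0"
  obtains h :: "'a poly" where
    "degree h > 0"
    "\<And>t. poly (map_poly to_ac t) c = 0 \<Longrightarrow> h dvd t"
    "order c (map_poly to_ac h) = 1"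
proof -
  define P where "P h \<longleftrightarrow> h \<noteq> 0 \<and> poly (map_poly to_ac h) c = 0" for h :: "'a poly"
  have "P w" using assms by (simp add: P_def)
  then obtain h where h: "P h" and min: "\<And>t. P t \<Longrightarrow> degree h \<le> degree t"
    using ex_has_least_nat[of P w degree] by blast
  have h0: "h \<noteq> 0" and hc: "poly (map_poly to_ac h) c = 0"
    using h by (auto simp: P_def)
  have deg: "degree h > 0"
  proof (rule ccontr)
    assume "\<not> degree h > 0"
    then obtain k where "h = [:k:]" by (metis degree_eq_zeroE gr0I)
    then show False using h0 hc by (simp add: map_poly_pCons)
  qed
  have dvd: "h dvd t" if "poly (map_poly to_ac t) c = 0" for t
  proof -
    have "map_poly to_ac t = map_poly to_ac (t div h) * map_poly to_ac h + map_poly to_ac (t mod h)"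
      by (simp flip: map_poly_to_ac_add map_poly_to_ac_mult)
    then have "poly (map_poly to_ac (t mod h)) c = 0"
      using that hc by simp
    then have "t mod h = 0"
      using min[of "t mod h"] degree_mod_less[OF h0, of t] by (auto simp: P_def not_le[symmetric])
    then show ?thesis by (simp add: mod_eq_0_iff_dvd)
  qed
  \<comment> \<open>Otherwise \<open>h\<close> is a proper power of some \<open>s\<close>, which has
    the root \<open>c\<close> and smaller degree.\<close>
  have "pderiv h \<noteq> 0"
  proof
    assume "pderiv h = 0"
    then obtain s where s: "h = s ^ CHAR('a)" by (rule pderiv_eq_0_imp_CHAR_power)
    then have "P s"
      using h0 hc by (auto simp: P_def map_poly_to_ac_power)
    then have le: "degree h \<le> degree s" by (rule min)
    have "degree h = CHAR('a) * degree s"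
      using \<open>P s\<close> by (simp add: s degree_power_eq P_def)
    moreover have "CHAR('a) > 1"
      using prime_CHAR_semidom[where ?'a = 'a] prime_gt_1_nat by simp
    ultimately show False using le deg by auto
  qed
  moreover have "degree (pderiv h) < degree h"
    using deg by (intro degree_lessI) (auto simp: coeff_pderiv coeff_eq_0)
  \<comment> \<open>Minimality of \<open>h\<close> excludes \<open>c\<close> as a root of the
    derivative, so \<open>c\<close> is a simple root of \<open>h\<close>.\<close>
  ultimately have sep: "poly (pderiv (map_poly to_ac h)) c \<noteq> 0"
    using min[of "pderiv h"] by (auto simp: P_def pderiv_map_poly_to_ac)
  have "\<not> [:-c, 1:] ^ 2 dvd map_poly to_ac h"
  proof
    assume "[:-c, 1:] ^ 2 dvd map_poly to_ac h"
    then obtain t where "map_poly to_ac h = [:-c, 1:] * ([:-c, 1:] * t)"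
      by (metis dvdE power2_eq_square mult.assoc)
    then show False using sep by (simp add: pderiv_mult del: mult_pCons_left)
  qed
  then have "order c (map_poly to_ac h) < 2"
    using order_divides h0 by (metis not_less)
  moreover have "order c (map_poly to_ac h) \<noteq> 0"
    using hc h0 by (simp add: order_root map_poly_to_ac_eq_0_iff)
  ultimately show ?thesis
    using that[OF deg dvd] by simp
qed

text \<open>Since \<open>c\<close> is a simple root of its minimal polynomial \<open>h\<close>, each
  factor \<open>h\<close> split off from \<open>w\<close> lowers the order at \<open>c\<close> by
  exactly one.\<close>

lemma ex_power_dvd_if_order_alg_closure:
  fixes c :: "'a::finite_field alg_closure" and w :: "'a poly"
  assumes "w \<noteq> 0" "n > 0" "n \<le> order c (map_poly to_ac w)"
  shows "\<exists>h. degree h > 0 \<and> h ^ n dvd w"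
proof -
  have "poly (map_poly to_ac w) c = 0"
    using assms by (simp add: order_root)
  then obtain h :: "'a poly" where h: "degree h > 0"
      "\<And>t. poly (map_poly to_ac t) c = 0 \<Longrightarrow> h dvd t"
      "order c (map_poly to_ac h) = 1"
    using alg_closure_separable_minimal_poly[OF assms(1)] by metis
  have "h ^ m dvd t" if "t \<noteq> 0" "m \<le> order c (map_poly to_ac t)" for m t
    using that
  proof (induction m arbitrary: t)
    case (Suc m)
    have "poly (map_poly to_ac t) c = 0"
      using Suc.prems by (simp add: order_root)
    then obtain s where s: "t = h * s" using h(2) by (meson dvdE)
    have "map_poly to_ac h * map_poly to_ac s \<noteq> 0"
      using Suc.prems(1) s by (auto simp: map_poly_to_ac_eq_0_iff)
    then have "m \<le> order c (map_poly to_ac s)"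
      using Suc.prems(2) h(3) by (simp add: s map_poly_to_ac_mult order_mult)
    then have "h ^ m dvd s" using Suc.IH Suc.prems(1) s by auto
    then show ?case by (simp add: s)
  qed simp
  then show ?thesis using assms(1,3) h(1) by blast
qed

section \<open>Reduced fractions and the pole argument\<close>

text \<open>In a representation with denominator of least degree, cancelling a nonconstant common
  factor would contradict minimality.\<close>

lemma fract_poly_lowest_terms:
  fixes g :: "'a::field poly fract"
  obtains a b where "g = Fract a b" "b \<noteq> 0" "coprime a b"
proof -
  define P where "P x \<longleftrightarrow> g = Fract (fst x) (snd x) \<and> snd x \<noteq> 0" for x
  obtain x where "P x"
    by (cases g) (use P_def in force)
  then obtain y where y: "P y" and min: "\<And>z. P z \<Longrightarrow> degree (snd y) \<le> degree (snd z)"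
    using ex_has_least_nat[of P x "\<lambda>z. degree (snd z)"] by blast
  have "coprime (fst y) (snd y)"
  proof (rule coprimeI)
    fix t assume "t dvd fst y" "t dvd snd y"
    then obtain a b where ab: "fst y = t * a" "snd y = t * b" by (metis dvdE)
    have nz: "t \<noteq> 0" "b \<noteq> 0" using y ab by (auto simp: P_def)
    have "P (a, b)" using y ab nz by (simp add: P_def eq_fract)
    then have "degree t = 0"
      using min[of "(a, b)"] nz by (simp add: ab degree_mult_eq)
    then show "is_unit t" using nz by (simp add: is_unit_iff_degree)
  qed
  then show ?thesis using that y by (auto simp: P_def)
qed

lemma Fract_power: "Fract a b ^ n = Fract (a ^ n) (b ^ n)"
  by (induction n) (simp_all add: One_fract_def)

theorem theorem2p10:
  fixes p k q r d :: nat
    and u v :: "'a::finite_field poly"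
    and f :: "'a poly fract"
  assumes "prime p" and "k \<ge> 1" and "q = p ^ k"
    and "r \<ge> 1"
    and "card (UNIV :: 'a set) = q ^ r"
    and "u \<noteq> 0" and "v \<noteq> 0"
    and "f = Fract u v"
    and "coprime u v"
    and "degree u \<le> degree v + 1"
    and "coprime (degree v) p"
    and "\<And>\<omega>::'a. \<omega> \<noteq> 0 \<Longrightarrow>
           \<not> (\<exists>h::'a poly. degree h > 0 \<and> h ^ p dvd v * pcompose v [:\<omega>, 1:])"
    and "d = ratfun_degree f"
  shows "f \<in> ratfun_class d"
proof -
  have "prime CHAR('a)"
    by (rule prime_CHAR_semidom) simp
  moreover have "CHAR('a) dvd p ^ (k * r)"
    using CHAR_dvd_CARD[where ?'a = 'a] assms(3,5) by (simp add: power_mult)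
  ultimately have char: "CHAR('a) = p"
    using assms(1) by (metis prime_dvd_power primes_dvd_imp_eq)
  have p1: "p > 1" using assms(1) by (rule prime_gt_1_nat)
  have False
    if "\<omega> \<noteq> 0" and eq: "ratfun_to_ac (ratfun_shift \<omega> f - f) =
          Fract [:to_ac \<alpha>:] 1 * (g ^ p - g) + Fract [:to_ac \<beta>:] 1 * Fract [:0, 1:] 1"
    for \<omega> \<alpha> \<beta> :: 'a and g :: "'a alg_closure poly fract"
  proof -
    define u' v' where "u' = pcompose u [:\<omega>, 1:]" and "v' = pcompose v [:\<omega>, 1:]"
    have v': "v' \<noteq> 0" using assms(7) by (simp add: v'_def pcompose_eq_0_iff)
    define N W where "N = map_poly to_ac (u' * v - u * v')" and "W = map_poly to_ac (v * v')"
    have W: "W \<noteq> 0" using v' assms(7) by (simp add: W_def map_poly_to_ac_eq_0_iff)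
    obtain a b where ab: "g = Fract a b" "b \<noteq> 0" "coprime a b"
      by (rule fract_poly_lowest_terms)
    \<comment> \<open>Numerator of the right-hand side over the common denominator
      \<open>b ^ p\<close>.\<close>
    define S where "S = [:to_ac \<alpha>:] * (a ^ p - a * b ^ (p - 1)) + [:to_ac \<beta>:] * [:0, 1:] * b ^ p"
    have bp: "b ^ p = b * b ^ (p - 1)" using p1 by (simp flip: power_Suc)
    have "ratfun_to_ac (ratfun_shift \<omega> f - f) = Fract N W"
      using assms(7) v'
      by (simp add: assms(8) ratfun_shift_Fract ratfun_to_ac_Fract N_def W_def
            flip: u'_def v'_def) (simp add: mult.commute)
    moreover have "Fract [:to_ac \<alpha>:] 1 * (g ^ p - g) + Fract [:to_ac \<beta>:] 1 * Fract [:0, 1:] 1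
        = Fract S (b ^ p)"
      using ab(2) by (simp only: ab(1) Fract_power mult_fract diff_fract add_fract eq_fract
            power_not_zero mult_eq_0_iff simp_thms one_neq_zero S_def bp) (simp only: algebra_simps mult_1_left mult_1_right)
    ultimately have NS: "N * b ^ p = S * W"
      using eq W ab(2) by (simp add: eq_fract)
    \<comment> \<open>This says that \<open>f(X + \<omega>) - f(X)\<close> is a polynomial.\<close>
    have "W dvd N"
    proof (cases "\<alpha> = 0")
      case True
      then have "N * b ^ p = (W * ([:to_ac \<beta>:] * [:0, 1:])) * b ^ p"
        using NS by (simp add: S_def mult_ac)
      then have "N = W * ([:to_ac \<beta>:] * [:0, 1:])"
        using ab(2) by (simp only: mult_cancel_right power_not_zero simp_thms)
      then show ?thesis by (rule dvdI)
    next
      case False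
      have "degree b = 0"
      proof (rule ccontr)
        assume "degree b \<noteq> 0"
        then obtain c where c: "poly b c = 0"
          using alg_closed_imp_poly_has_root by blast
        have "poly a c \<noteq> 0"
        proof
          assume "poly a c = 0"
          then have "is_unit [:-c, 1:]"
            using c ab(3) by (metis poly_eq_0_iff_dvd coprime_common_divisor)
          then show False by (simp add: is_unit_pCons_iff)
        qed
        \<comment> \<open>At the pole \<open>c\<close>, all terms of \<open>S\<close> containing
          \<open>b\<close> vanish (\<open>p > 1\<close> matters for \<open>b ^ (p - 1)\<close>),
          leaving \<open>\<alpha> * a(c) ^ p\<close>. Hence the zero of \<open>b ^ p\<close> at
          \<open>c\<close> must be absorbed by \<open>W\<close>.\<close>
        then have Sc: "poly S c \<noteq> 0"
          using False c p1 by (simp add: S_def power_0_left)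
        then have "S * W \<noteq> 0" using W by auto
        have "[:-c, 1:] ^ p dvd S * W"
          using c dvd_power_same[of "[:-c, 1:]" b p] by (simp add: poly_eq_0_iff_dvd flip: NS)
        then have "p \<le> order c (S * W)"
          using \<open>S * W \<noteq> 0\<close> by (simp add: order_divides)
        then have "p \<le> order c W"
          using Sc \<open>S * W \<noteq> 0\<close> by (simp add: order_mult order_0I)
        then show False
          using ex_power_dvd_if_order_alg_closure[of "v * v'" p c] assms(7,12) v' p1 \<open>\<omega> \<noteq> 0\<close>
          by (auto simp: W_def v'_def)
      qed
      then have "is_unit (b ^ p)" using ab(2) by (simp add: is_unit_iff_degree is_unit_power_iff)
      then show ?thesis using NS by (metis dvd_mult_unit_iff dvd_triv_right)
    qed
    let ?V = "map_poly to_ac v" and ?V' = "map_poly to_ac v'" and ?U = "map_poly to_ac u"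
    have "?V dvd N"
      using \<open>W dvd N\<close> by (metis W_def map_poly_to_ac_mult dvd_mult_left)
    moreover have "N = map_poly to_ac u' * ?V - ?U * ?V'"
      by (simp add: N_def map_poly_to_ac_mult map_poly_to_ac_diff)
    ultimately have "?V dvd ?U * ?V'"
      by (metis dvd_diff_right_iff dvd_triv_right)
    \<comment> \<open>A Bezout identity carries coprimality over to the closure.\<close>
    moreover have "coprime ?V ?U"
    proof -
      obtain s t where "s * u + t * v = 1" using poly_bezout[OF assms(9)] by blast
      then have "map_poly to_ac s * ?U + map_poly to_ac t * ?V = 1"
        by (metis map_poly_to_ac_1 map_poly_to_ac_add map_poly_to_ac_mult)
      then show ?thesis
        by (intro coprimeI) (metis dvd_add dvd_mult)
    qed
    ultimately have "?V dvd ?V'" using poly_coprime_dvd_multD by blast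
    \<comment> \<open>Translation preserves degree and leading coefficient, so divisibility becomes
      equality.\<close>
    moreover have deg: "degree v' = degree v"
      by (simp add: v'_def degree_pcompose)
    moreover have "lead_coeff v' = lead_coeff v"
      by (simp add: v'_def lead_coeff_comp)
    ultimately have "?V = ?V'"
      using assms(7) by (intro poly_dvd_same_lead_imp_eq)
        (simp_all add: map_poly_to_ac_eq_0_iff degree_map_poly_to_ac coeff_map_poly)
    then have "pcompose v [:\<omega>, 1:] = v" by (simp add: map_poly_to_ac_eq_iff v'_def)
    then have "p dvd degree v"
      using CHAR_dvd_degree_if_translation_invariant \<open>\<omega> \<noteq> 0\<close> char by blast
    then have "is_unit p"
      using assms(11) by (meson coprime_common_divisor dvd_refl)
    then show False using p1 by simp
  qed
  then show ?thesis
    using assms(13) unfolding ratfun_class_def char by blast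
qed

end
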